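(* Let $R$ be an associative ring (not necessarily unital) and let $\operatorname{Nil}(R)$ denote its set of nilpotent elements. The following are equivalent: (i) $\operatorname{Nil}(R)$ is additively closed; (ii) $\operatorname{Nil}(R)$ is multiplicatively closed and $R$ satisfies Köthe's conjecture; (iii) $\operatorname{Nil}(R)$ is closed under the operation $x\circ y=x+y-xy$; (iv) $\operatorname{Nil}(R)$ is a subring of $R$.
   Context: Rings are associative and not necessarily unital. A ring $R$ is said to satisfy Köthe's conjecture if every nil left ideal of $R$ is contained in a nil two-sided ideal of $R$ (equivalently, the sum of two nil left ideals of $R$ is a nil left ideal). For $x,y\in R$, $x\circ y=x+y-xy$. *)

theory Defs
  imports Main
begin

text \<open>Rings are associative, not necessarily unital: Isabelle type class ring.
  Positive powers in a non-unital ring: npow x n = x^(n+1).\<close>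

definition npow :: "'a::ring \<Rightarrow> nat \<Rightarrow> 'a" where
  "npow x n = ((\<lambda>y. x * y) ^^ n) x"

definition nilpotent :: "'a::ring \<Rightarrow> bool" where
  "nilpotent x \<longleftrightarrow> (\<exists>n. npow x n = 0)"

definition Nil_set :: "'a::ring set" where
  "Nil_set = {x. nilpotent x}"

definition circ :: "'a::ring \<Rightarrow> 'a \<Rightarrow> 'a" where
  "circ x y = x + y - x * y"

definition additive_subgroup :: "'a::ring set \<Rightarrow> bool" where
  "additive_subgroup I \<longleftrightarrow> 0 \<in> I \<and> (\<forall>x\<in>I. \<forall>y\<in>I. x - y \<in> I)"

definition left_ideal :: "'a::ring set \<Rightarrow> bool" where
  "left_ideal I \<longleftrightarrow> additive_subgroup I \<and> (\<forall>r x. x \<in> I \<longrightarrow> r * x \<in> I)"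

definition two_sided_ideal :: "'a::ring set \<Rightarrow> bool" where
  "two_sided_ideal I \<longleftrightarrow> additive_subgroup I \<and>
     (\<forall>r x. x \<in> I \<longrightarrow> r * x \<in> I \<and> x * r \<in> I)"

definition nil_set :: "'a::ring set \<Rightarrow> bool" where
  "nil_set I \<longleftrightarrow> I \<subseteq> Nil_set"

definition subring :: "'a::ring set \<Rightarrow> bool" where
  "subring S \<longleftrightarrow> additive_subgroup S \<and> (\<forall>x\<in>S. \<forall>y\<in>S. x * y \<in> S)"

definition satisfies_Koethe :: "'a::ring itself \<Rightarrow> bool" where
  "satisfies_Koethe _ \<longleftrightarrow> (\<forall>L::'a set. left_ideal L \<and> nil_set L \<longrightarrow>
      (\<exists>J. two_sided_ideal J \<and> nil_set J \<and> L \<subseteq> J))"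

end

theory Submission
  imports Defs
begin

text \<open>
  Let \<open>N\<close> be the set of nilpotents and \<open>J = {x. x R \<subseteq> N}\<close>. Each of the conditions on \<open>N\<close> makes \<open>J\<close>
  a nil ideal with the insertion property: \<open>u v \<in> J\<close> and \<open>x \<in> N\<close> imply \<open>u x v \<in> J\<close>. The reason is that
  \<open>s = v r u\<close> satisfies \<open>s s \<in> J\<close> for every \<open>r\<close>, which forces \<open>s x \<in> N\<close>; rotating the product cyclically
  gives \<open>u x v r \<in> N\<close> for every \<open>r\<close>. Inserting nilpotents between the factors of \<open>a\<^sup>n = 0\<close> shows that
  every word with \<open>n\<close> occurrences of \<open>a\<close> and nilpotents in between lies in \<open>J\<close>, so \<open>b a\<close> and \<open>a + b\<close> are
  nilpotent for all nilpotent \<open>a\<close> and \<open>b\<close>.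
\<close>

section \<open>Powers without a unit\<close>

text \<open>\<open>rpow u x k\<close> is \<open>u x\<^sup>k\<close>; unlike \<open>npow\<close> it allows the exponent 0.\<close>

primrec rpow :: "'a::ring \<Rightarrow> 'a \<Rightarrow> nat \<Rightarrow> 'a" where
  "rpow u x 0 = u"
| "rpow u x (Suc k) = rpow u x k * x"

lemma rpow_add: "rpow u x (i + j) = rpow (rpow u x i) x j"
  by (induction j) auto

lemma rpow_Suc_left: "rpow u x (Suc k) = rpow (u * x) x k"
  by (induction k) auto

lemma rpow_mult: "rpow (v * u) x k = v * rpow u x k"
  by (induction k) (auto simp: mult.assoc)

lemma rpow_plus: "rpow (u + v) x k = rpow u x k + rpow v x k"
  by (induction k) (auto simp: algebra_simps)

lemma rpow_diff: "rpow (u - v) x k = rpow u x k - rpow v x k"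
  by (induction k) (auto simp: left_diff_distrib)

lemma rpow_zero [simp]: "rpow 0 x k = 0"
  by (induction k) auto

lemma npow_0 [simp]: "npow x 0 = x"
  by (simp add: npow_def)

lemma npow_Suc: "npow x (Suc k) = x * npow x k"
  by (simp add: npow_def)

lemma npow_eq_rpow: "npow x k = rpow x x k"
proof (induction k)
  case (Suc k)
  have "npow x (Suc k) = rpow (x * x) x k"
    by (simp only: npow_Suc Suc rpow_mult)
  then show ?case by (simp only: rpow_Suc_left)
qed simp

lemma rpow_Suc_npow: "rpow u x (Suc k) = u * npow x k"
  by (simp only: npow_eq_rpow rpow_Suc_left rpow_mult)

lemma rpow_npow: "rpow u (npow x i) k = rpow u x (Suc i * k)"
proof (induction k)
  case (Suc k)
  have "rpow u (npow x i) (Suc k) = rpow (rpow u x (Suc i * k)) x (Suc i)"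
    by (simp only: rpow.simps(2)[of u "npow x i"] Suc rpow_Suc_npow[of "rpow u x (Suc i * k)"])
  also have "\<dots> = rpow u x (Suc i * Suc k)"
    by (metis rpow_add mult_Suc_right add.commute)
  finally show ?case .
qed simp

text \<open>The free left factor \<open>u\<close> stands in for a unit: right multiplication by
  \<open>x\<close> is a nilpotent map, and exponents start at 0.\<close>

lemma nilpotent_iff_rpow: "nilpotent x \<longleftrightarrow> (\<exists>k. \<forall>u. rpow u x k = 0)"
proof
  assume "nilpotent x"
  then obtain n where "npow x n = 0" by (auto simp: nilpotent_def)
  then have "\<forall>u. rpow u x (Suc n) = 0" by (simp only: rpow_Suc_npow) simp
  then show "\<exists>k. \<forall>u. rpow u x k = 0" by blast
qed (auto simp: nilpotent_def npow_eq_rpow)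

lemma nilpotent_of_npow:
  assumes "nilpotent (npow x i)" shows "nilpotent x"
  using assms unfolding nilpotent_iff_rpow by (auto simp only: rpow_npow)

lemma nilpotent_npow:
  assumes "nilpotent x" shows "nilpotent (npow x i)"
proof -
  obtain k where k: "\<And>u. rpow u x k = 0" using assms by (auto simp: nilpotent_iff_rpow)
  have "rpow u (npow x i) k = 0" for u
  proof -
    have "rpow u (npow x i) k = rpow (rpow u x (i * k)) x k"
      by (simp only: rpow_npow) (metis rpow_add mult_Suc add.commute)
    then show ?thesis using k by simp
  qed
  then show ?thesis by (auto simp: nilpotent_iff_rpow)
qed

lemma nilpotent_of_square: "nilpotent (x * x) \<Longrightarrow> nilpotent x"
  using nilpotent_of_npow[of x 1] by (simp add: npow_Suc)

lemma nilpotent_square: "nilpotent x \<Longrightarrow> nilpotent (x * x)"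
  using nilpotent_npow[of x 1] by (simp add: npow_Suc)

lemma rpow_uminus: "rpow u (- x) k = rpow u x k \<or> rpow u (- x) k = - rpow u x k"
  by (induction k) auto

lemma nilpotent_uminus: "nilpotent x \<Longrightarrow> nilpotent (- x)"
  unfolding nilpotent_iff_rpow by (metis rpow_uminus neg_equal_0_iff_equal)

lemma rpow_rotate: "rpow u (y * x) (Suc k) = rpow (u * y) (x * y) k * x"
  by (induction k) (auto simp: mult.assoc)

text \<open>\<open>u (y x)^(k+1) = u y (x y)^k x\<close>.\<close>

lemma nilpotent_mult_commute:
  assumes "nilpotent (x * y)" shows "nilpotent (y * x)"
proof -
  obtain k where "\<And>u. rpow u (x * y) k = 0" using assms by (auto simp: nilpotent_iff_rpow)
  then have "\<And>u. rpow u (y * x) (Suc k) = 0" by (simp only: rpow_rotate) simp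
  then show ?thesis unfolding nilpotent_iff_rpow by blast
qed

text \<open>The partial sums of the geometric series give \<open>(1 - x)\<^sup>-\<^sup>1 = 1 + w\<close>.\<close>

lemma nilpotent_quasi_inverse:
  assumes "nilpotent x" obtains w where "w = x + x * w"
proof -
  obtain n where n: "npow x n = 0" using assms by (auto simp: nilpotent_def)
  define g where "g k = ((\<lambda>w. x + x * w) ^^ k) x" for k
  have "g (Suc k) - g k = npow x (Suc k)" for k
  proof (induction k)
    case (Suc k)
    have "g (Suc (Suc k)) - g (Suc k) = x * (g (Suc k) - g k)"
      by (simp add: g_def algebra_simps)
    then show ?case by (simp only: Suc npow_Suc)
  qed (simp add: g_def npow_Suc)
  from this[of n] have "g n = x + x * g n"
    using n by (simp add: npow_Suc g_def)
  then show ?thesis by (rule that)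
qed

section \<open>Nil ideals with the insertion property\<close>

lemma two_sided_idealD:
  assumes "two_sided_ideal J"
  shows ideal_zero: "0 \<in> J"
    and ideal_diff: "\<And>x y. x \<in> J \<Longrightarrow> y \<in> J \<Longrightarrow> x - y \<in> J"
    and ideal_mult_left: "\<And>r x. x \<in> J \<Longrightarrow> r * x \<in> J"
    and ideal_mult_right: "\<And>r x. x \<in> J \<Longrightarrow> x * r \<in> J"
  using assms by (auto simp: two_sided_ideal_def additive_subgroup_def)

lemma ideal_uminus: "two_sided_ideal J \<Longrightarrow> x \<in> J \<Longrightarrow> - x \<in> J"
  using ideal_diff[of J 0 x] ideal_zero[of J] by simp

lemma ideal_add: "two_sided_ideal J \<Longrightarrow> x \<in> J \<Longrightarrow> y \<in> J \<Longrightarrow> x + y \<in> J"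
  using ideal_diff[of J x "- y"] ideal_uminus[of J y] by simp

lemma ideal_rpow: "two_sided_ideal J \<Longrightarrow> u \<in> J \<Longrightarrow> rpow u x k \<in> J"
  by (induction k) (auto intro: ideal_mult_right)

lemma nilpotent_of_rpow_in_nil_ideal:
  assumes "nil_set J" "\<And>u. rpow u x k \<in> J"
  shows "nilpotent x"
  using assms nilpotent_of_npow[of x k] by (auto simp: nil_set_def Nil_set_def npow_eq_rpow)

text \<open>For an ideal \<open>J\<close>, this is the insertion-of-factors property of the quotient
  by \<open>J\<close>, restricted to the inserted factor \<open>x\<close>.\<close>

definition insertion :: "'a::ring set \<Rightarrow> 'a \<Rightarrow> bool" where
  "insertion J x \<longleftrightarrow> (\<forall>u v. u * v \<in> J \<longrightarrow> u * x * v \<in> J)"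

lemma insertion_rpow:
  assumes "two_sided_ideal J" "insertion J x" "rpow u a m \<in> J"
  shows "rpow (u * x) a m \<in> J"
proof (cases m)
  \<comment> \<open>No factor \<open>a\<close> follows the place of insertion, so the ideal itself
    absorbs \<open>x\<close>.\<close>
  case 0
  then show ?thesis using assms by (simp add: ideal_mult_right)
next
  case (Suc k)
  then show ?thesis using assms(2,3) by (simp add: insertion_def rpow_Suc_npow del: rpow.simps)
qed

text \<open>In \<open>u a^n = 0\<close>, a \<open>b\<close> is inserted before each \<open>a\<close>
  from left to right; the finished part \<open>u (b a)\<close> becomes the new
  \<open>u\<close>.\<close>

lemma nilpotent_mult_if_insertion:
  assumes J: "two_sided_ideal J" "nil_set J" and a: "nilpotent a" and b: "insertion J b"
  shows "nilpotent (b * a)"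
proof -
  obtain n where n: "\<And>u. rpow u a n = 0" using a by (auto simp: nilpotent_iff_rpow)
  have "rpow u a m \<in> J \<Longrightarrow> rpow u (b * a) m \<in> J" for u m
  proof (induction m arbitrary: u)
    case (Suc m)
    have "rpow (u * b) a (Suc m) \<in> J" by (rule insertion_rpow[OF J(1) b Suc.prems])
    then have "rpow (u * (b * a)) a m \<in> J" by (simp only: rpow_Suc_left mult.assoc)
    from Suc.IH[OF this] show ?case by (simp only: rpow_Suc_left)
  qed simp
  then have "rpow u (b * a) n \<in> J" for u using n ideal_zero[OF J(1)] by simp
  then show ?thesis by (rule nilpotent_of_rpow_in_nil_ideal[OF J(2)])
qed

text \<open>Modulo \<open>{u. u a\<^sup>m \<in> J}\<close>, right multiplication by \<open>a + b\<close> on \<open>{u. u a\<^bsup>m+1\<^esup> \<in> J}\<close> agrees with right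
  multiplication by \<open>b\<close>; so a power of \<open>a + b\<close> maps the latter set into the former.\<close>

lemma nilpotent_add_if_insertion:
  assumes J: "two_sided_ideal J" "nil_set J" and a: "nilpotent a"
    and b: "nilpotent b" "insertion J b"
  shows "nilpotent (a + b)"
proof -
  obtain n where n: "\<And>u. rpow u a n = 0" using a by (auto simp: nilpotent_iff_rpow)
  obtain q where q: "\<And>u. rpow u b q = 0" using b(1) by (auto simp: nilpotent_iff_rpow)
  have D_a: "rpow (u * a) a m \<in> J" if "rpow u a m \<in> J" for u m
    using ideal_mult_right[OF J(1) that, of a] by (simp flip: rpow_Suc_left)
  have D_b: "rpow (u * b) a m \<in> J" if "rpow u a m \<in> J" for u m
    by (rule insertion_rpow[OF J(1) b(2) that])
  have D_bs: "rpow (rpow u b j) a m \<in> J" if "rpow u a m \<in> J" for u m j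
    using that by (induction j) (auto intro: D_b)
  have step: "rpow (rpow u (a + b) j - rpow u b j) a m \<in> J" if "rpow u a (Suc m) \<in> J" for u m j
  proof (induction j)
    case 0
    then show ?case by (simp add: ideal_zero[OF J(1)])
  next
    case (Suc j)
    let ?d = "rpow u (a + b) j - rpow u b j"
    have eq: "rpow u (a + b) (Suc j) - rpow u b (Suc j) = ?d * a + ?d * b + rpow u b j * a"
      by (simp add: algebra_simps)
    have "rpow (rpow u b j * a) a m \<in> J"
      using D_bs[OF that, of j] by (simp only: rpow_Suc_left)
    then show ?case unfolding eq rpow_plus
      by (simp add: ideal_add[OF J(1)] D_a D_b Suc)
  qed
  have "rpow u a m \<in> J \<Longrightarrow> rpow u (a + b) (q * m) \<in> J" for u m
  proof (induction m arbitrary: u)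
    case (Suc m)
    \<comment> \<open>At \<open>j = q\<close> the term \<open>rpow u b q\<close> vanishes, so
      \<open>q\<close> factors \<open>a + b\<close> lower the exponent of \<open>a\<close> by
      one.\<close>
    have "rpow (rpow u (a + b) q) a m \<in> J" using step[OF Suc.prems, of q] q by simp
    from Suc.IH[OF this] show ?case by (simp add: rpow_add)
  qed simp
  then have "rpow u (a + b) (q * n) \<in> J" for u using n ideal_zero[OF J(1)] by simp
  then show ?thesis by (rule nilpotent_of_rpow_in_nil_ideal[OF J(2)])
qed

section \<open>The set of elements generating nil right ideals\<close>

text \<open>If closed under subtraction, this is the largest nil ideal; Koethe's conjecture for the
  ring provides that closure.\<close>

definition nil_radical :: "'a::ring set" where
  "nil_radical = {x. \<forall>r. nilpotent (x * r)}"

lemma nil_radical_nilpotent: "x \<in> nil_radical \<Longrightarrow> nilpotent x"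
  using nilpotent_of_square by (auto simp: nil_radical_def)

lemma nil_set_nil_radical: "nil_set nil_radical"
  using nil_radical_nilpotent by (auto simp: nil_set_def Nil_set_def)

lemma nil_radical_mult_right: "x \<in> nil_radical \<Longrightarrow> x * r \<in> nil_radical"
  by (auto simp: nil_radical_def mult.assoc)

text \<open>\<open>r x t\<close> is nilpotent because its rotation \<open>x t r\<close> is.\<close>

lemma nil_radical_mult_left:
  assumes "x \<in> nil_radical" shows "r * x \<in> nil_radical"
proof -
  have "nilpotent (r * x * t)" for t
    using assms nilpotent_mult_commute[of "x * t" r]
    by (auto simp: nil_radical_def mult.assoc)
  then show ?thesis by (simp add: nil_radical_def)
qed

lemma nil_radical_uminus: "x \<in> nil_radical \<Longrightarrow> - x \<in> nil_radical"
  using nilpotent_uminus by (fastforce simp: nil_radical_def)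

text \<open>\<open>(x - y) r = x r - y r\<close>, and \<open>x r\<close>, \<open>y r\<close> are
  again in the set.\<close>

lemma two_sided_ideal_nil_radical:
  assumes "\<And>x y :: 'a::ring. x \<in> nil_radical \<Longrightarrow> y \<in> nil_radical \<Longrightarrow> nilpotent (x - y)"
  shows "two_sided_ideal (nil_radical :: 'a set)"
proof -
  have "x - y \<in> nil_radical" if "x \<in> nil_radical" "y \<in> nil_radical" for x y :: 'a
    using assms[OF nil_radical_mult_right nil_radical_mult_right] that
    by (simp add: nil_radical_def left_diff_distrib)
  moreover have "0 \<in> (nil_radical :: 'a set)"
    by (auto simp: nil_radical_def nilpotent_def intro: exI[of _ 0])
  ultimately show ?thesis
    by (auto simp: two_sided_ideal_def additive_subgroup_def
        nil_radical_mult_left nil_radical_mult_right)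
qed

lemma insertion_nil_radicalI:
  assumes "\<And>u v r. u * v \<in> nil_radical \<Longrightarrow> nilpotent (v * r * u * x)"
  shows "insertion nil_radical x"
  unfolding insertion_def
proof (intro allI impI)
  fix u v :: 'a
  assume "u * v \<in> nil_radical"
  from assms[OF this] have "nilpotent (u * x * (v * r))" for r
    using nilpotent_mult_commute[of "v * r" "u * x"] by (simp add: mult.assoc)
  then show "u * x * v \<in> nil_radical" by (simp add: nil_radical_def mult.assoc)
qed

text \<open>The square is \<open>v r (u v) r u\<close>.\<close>

lemma sandwich_square_in_nil_radical:
  assumes "u * v \<in> nil_radical"
  shows "(v * r * u) * (v * r * u) \<in> nil_radical"
  using nil_radical_mult_left[OF nil_radical_mult_right[OF assms, of "r * u"], of "v * r"]
  by (simp add: mult.assoc)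

lemma nil_left_ideal_subset_nil_radical:
  assumes "left_ideal L" "nil_set L"
  shows "L \<subseteq> nil_radical"
proof
  fix x assume "x \<in> L"
  then have "nilpotent (r * x)" for r
    using assms by (auto simp: left_ideal_def nil_set_def Nil_set_def)
  then show "x \<in> nil_radical" by (simp add: nil_radical_def nilpotent_mult_commute)
qed

text \<open>The first two hypotheses are the common target of the three closure conditions treated
  below.\<close>

lemma nilpotent_closed_if_insertion:
  fixes x y :: "'a::ring"
  assumes "two_sided_ideal (nil_radical :: 'a set)"
    and "\<And>x :: 'a. nilpotent x \<Longrightarrow> insertion nil_radical x"
    and "nilpotent x" "nilpotent y"
  shows "nilpotent (x + y)" "nilpotent (x * y)"
  using assms nil_set_nil_radical nilpotent_add_if_insertion nilpotent_mult_if_insertion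
  by blast+

section \<open>Additively closed nilpotents\<close>

text \<open>Polarisation: \<open>c = s x + x s\<close> is \<open>(s + x)^2 - s^2 - x^2\<close>, a
  sum of nilpotents.\<close>

lemma nilpotent_mult_square_in_ideal_if_add_closed:
  fixes s x :: "'a::ring"
  assumes add: "\<And>x y :: 'a. nilpotent x \<Longrightarrow> nilpotent y \<Longrightarrow> nilpotent (x + y)"
    and J: "two_sided_ideal J" "nil_set J" and s: "s * s \<in> J" and x: "nilpotent x"
  shows "nilpotent (s * x)"
proof -
  define c where "c = s * x + x * s"
  have ss: "nilpotent (s * s)" using J s by (auto simp: nil_set_def Nil_set_def)
  then have "nilpotent s" by (rule nilpotent_of_square)
  then have "nilpotent ((s + x) * (s + x) + (- (s * s) + - (x * x)))"
    by (intro add nilpotent_uminus nilpotent_square ss x)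
  moreover have "(s + x) * (s + x) + (- (s * s) + - (x * x)) = c"
    by (simp add: c_def algebra_simps)
  ultimately obtain n where n: "\<And>u. rpow u c n = 0" by (auto simp: nilpotent_iff_rpow)
  \<comment> \<open>Modulo \<open>J\<close>, a word ending in \<open>s\<close> loses the summand
    \<open>s x\<close> of \<open>c\<close>, and the other summand \<open>x s\<close> makes it end in
    \<open>s\<close> again.\<close>
  have cong: "rpow s c k - rpow s (x * s) k \<in> J" for k
  proof (induction k)
    case 0
    then show ?case by (simp add: ideal_zero[OF J(1)])
  next
    case (Suc k)
    have "rpow s (x * s) k * s \<in> J"
    proof (cases k)
      case (Suc i)
      then have "rpow s (x * s) k * s = rpow s (x * s) i * x * (s * s)"
        by (simp add: mult.assoc)
      then show ?thesis using ideal_mult_left[OF J(1) s] by simp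
    qed (use s in simp)
    moreover have "rpow s c (Suc k) - rpow s (x * s) (Suc k)
        = (rpow s c k - rpow s (x * s) k) * c + rpow s (x * s) k * s * x"
      by (simp add: c_def algebra_simps)
    ultimately show ?case using Suc by (simp add: ideal_add ideal_mult_right J(1))
  qed
  from cong[of n] n have "rpow s (x * s) n \<in> J" using ideal_uminus[OF J(1)] by fastforce
  then have "x * rpow s (x * s) n \<in> J" by (rule ideal_mult_left[OF J(1)])
  then have "npow (x * s) n \<in> J" by (simp add: npow_eq_rpow rpow_mult)
  then have "nilpotent (x * s)"
    using J(2) nilpotent_of_npow by (auto simp: nil_set_def Nil_set_def)
  then show ?thesis by (rule nilpotent_mult_commute)
qed

lemma add_closed_imp:
  assumes add: "\<And>x y :: 'a::ring. nilpotent x \<Longrightarrow> nilpotent y \<Longrightarrow> nilpotent (x + y)"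
  shows "two_sided_ideal (nil_radical :: 'a set)"
    and "\<And>x :: 'a. nilpotent x \<Longrightarrow> insertion nil_radical x"
proof -
  show ideal: "two_sided_ideal (nil_radical :: 'a set)"
  proof (rule two_sided_ideal_nil_radical)
    fix x y :: 'a
    assume "x \<in> nil_radical" "y \<in> nil_radical"
    then have "nilpotent (x + - y)" by (intro add nilpotent_uminus nil_radical_nilpotent)
    then show "nilpotent (x - y)" by simp
  qed
  show "insertion nil_radical x" if "nilpotent x" for x :: 'a
    by (intro insertion_nil_radicalI nilpotent_mult_square_in_ideal_if_add_closed[OF add ideal]
        nil_set_nil_radical sandwich_square_in_nil_radical that)
qed

section \<open>Multiplicatively closed nilpotents and Koethe's conjecture\<close>

text \<open>Modulo \<open>K\<close>, the powers of \<open>x - y\<close> agree with those of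
  \<open>x\<close>, so one of them falls into the nil ideal \<open>K\<close>.\<close>

lemma nilpotent_diff_nil_ideals:
  assumes I: "two_sided_ideal I" "nil_set I" and K: "two_sided_ideal K" "nil_set K"
    and x: "x \<in> I" and y: "y \<in> K"
  shows "nilpotent (x - y)"
proof -
  have "nilpotent x" using I x by (auto simp: nil_set_def Nil_set_def)
  then obtain n where n: "\<And>u. rpow u x n = 0" by (auto simp: nilpotent_iff_rpow)
  have "rpow u (x - y) k - rpow u x k \<in> K" for u k
  proof (induction k)
    case 0
    then show ?case by (simp add: ideal_zero[OF K(1)])
  next
    case (Suc k)
    have "rpow u (x - y) (Suc k) - rpow u x (Suc k)
        = (rpow u (x - y) k - rpow u x k) * x - rpow u (x - y) k * y"
      by (simp add: algebra_simps)
    then show ?case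
      using Suc y by (simp add: ideal_diff ideal_mult_left ideal_mult_right K(1))
  qed
  from this[of _ n] n have "rpow u (x - y) n \<in> K" for u by simp
  then show ?thesis by (rule nilpotent_of_rpow_in_nil_ideal[OF K(2)])
qed

lemma left_ideal_principal: "left_ideal (range (\<lambda>r. r * x))"
  unfolding left_ideal_def additive_subgroup_def
proof (intro conjI ballI allI impI)
  show "0 \<in> range (\<lambda>r. r * x)" by (rule range_eqI[of _ _ 0]) simp
  show "y - z \<in> range (\<lambda>r. r * x)"
    if "y \<in> range (\<lambda>r. r * x)" "z \<in> range (\<lambda>r. r * x)" for y z
    using that by (auto simp flip: left_diff_distrib)
  show "t * y \<in> range (\<lambda>r. r * x)" if "y \<in> range (\<lambda>r. r * x)" for t y
    using that by (auto simp flip: mult.assoc)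
qed

lemma Koethe_imp_ideal_nil_radical:
  assumes "satisfies_Koethe TYPE('a::ring)"
  shows "two_sided_ideal (nil_radical :: 'a set)"
proof (rule two_sided_ideal_nil_radical)
  fix x y :: 'a
  assume xy: "x \<in> nil_radical" "y \<in> nil_radical"
  have ex: "\<exists>J. two_sided_ideal J \<and> nil_set J \<and> range (\<lambda>r. r * z) \<subseteq> J"
    if "z \<in> nil_radical" for z :: 'a
  proof -
    have "nil_set (range (\<lambda>r. r * z))"
      using that nilpotent_mult_commute by (auto simp: nil_radical_def nil_set_def Nil_set_def)
    then show ?thesis using assms left_ideal_principal unfolding satisfies_Koethe_def by blast
  qed
  obtain I where I: "two_sided_ideal I" "nil_set I" "range (\<lambda>r. r * x) \<subseteq> I"
    using ex[OF xy(1)] by blast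
  obtain K where K: "two_sided_ideal K" "nil_set K" "range (\<lambda>r. r * y) \<subseteq> K"
    using ex[OF xy(2)] by blast
  \<comment> \<open>Without a unit, \<open>x\<close> need not lie in \<open>R x\<close>; hence the
    square of \<open>x - y\<close> is treated, as a difference of elements of \<open>I\<close> and
    \<open>K\<close>.\<close>
  have "nilpotent ((x - y) * x - (x - y) * y)"
    by (rule nilpotent_diff_nil_ideals[OF I(1,2) K(1,2)]) (use I(3) K(3) in auto)
  then have "nilpotent ((x - y) * (x - y))"
    by (simp only: right_diff_distrib)
  then show "nilpotent (x - y)" by (rule nilpotent_of_square)
qed

text \<open>\<open>s = v r u\<close> has its square in the nil set, so \<open>s\<close> is nilpotent
  and \<open>s x\<close> is a product of nilpotents.\<close>

lemma mult_closed_imp_insertion: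
  assumes mult: "\<And>x y :: 'a::ring. nilpotent x \<Longrightarrow> nilpotent y \<Longrightarrow> nilpotent (x * y)"
    and x: "nilpotent (x :: 'a)"
  shows "insertion nil_radical x"
  by (intro insertion_nil_radicalI mult x
      nilpotent_of_square[OF nil_radical_nilpotent[OF sandwich_square_in_nil_radical]])

section \<open>Nilpotents closed under the circle operation\<close>

text \<open>If \<open>1 + w\<close> inverts \<open>1 - x\<close>, then \<open>x + y\<close> is the circle product of \<open>x\<close> and \<open>(1 + w) y\<close>, and the latter
  is nilpotent because \<open>y (1 + w)\<close> is.\<close>

lemma circ_closed_imp_ideal_nil_radical:
  assumes circ: "\<And>x y :: 'a::ring. nilpotent x \<Longrightarrow> nilpotent y \<Longrightarrow> nilpotent (circ x y)"
  shows "two_sided_ideal (nil_radical :: 'a set)"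
proof (rule two_sided_ideal_nil_radical)
  fix x z :: 'a
  assume x: "x \<in> nil_radical" and z: "z \<in> nil_radical"
  define y where "y = - z"
  have y: "y \<in> nil_radical" using z by (simp add: y_def nil_radical_uminus)
  obtain w where w: "w = x + x * w"
    using nilpotent_quasi_inverse nil_radical_nilpotent[OF x] by blast
  \<comment> \<open>\<open>y + y w\<close> is not visibly of the form \<open>y r\<close>, but its
    square is.\<close>
  have "nilpotent (y * (y + w * y + y * w + w * (y * w)))"
    using y by (simp add: nil_radical_def)
  then have "nilpotent ((y + y * w) * (y + y * w))"
    by (simp add: algebra_simps)
  then have "nilpotent (y + y * w)"
    by (rule nilpotent_of_square)
  \<comment> \<open>\<open>1 + w\<close> is not a ring element, so the cyclic rotation is redone by
    hand.\<close>
  moreover have rotate: "rpow u (y + w * y) (Suc k) = rpow (u + u * w) (y + y * w) k * y" for u k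
    by (induction k) (auto simp: algebra_simps)
  ultimately have "nilpotent (y + w * y)"
    unfolding nilpotent_iff_rpow by (metis mult_zero_left)
  then have "nilpotent (circ x (y + w * y))"
    by (intro circ nil_radical_nilpotent[OF x])
  moreover have "circ x (y + w * y) = x + y"
  proof -
    have "w * y = x * y + x * w * y" by (subst w) (simp add: algebra_simps)
    then show ?thesis by (simp add: circ_def algebra_simps)
  qed
  ultimately show "nilpotent (x - z)" by (simp add: y_def)
qed

text \<open>Modulo \<open>J\<close>, \<open>s\<close> and \<open>x\<close> behave like the matrix units \<open>E\<^sub>1\<^sub>2\<close> and \<open>z E\<^sub>2\<^sub>1\<close>. The matrix \<open>e\<close> then satisfies
  \<open>e\<^sup>2 = z - z e\<close>, whence the recursion for \<open>s e\<^sup>k s\<close>.\<close>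

lemma nilpotent_mult_square_in_ideal_if_circ_closed:
  fixes s x :: "'a::ring"
  assumes circ: "\<And>x y :: 'a. nilpotent x \<Longrightarrow> nilpotent y \<Longrightarrow> nilpotent (circ x y)"
    and J: "two_sided_ideal J" "nil_set J" and s: "s * s \<in> J" and x: "nilpotent x"
    and sxs: "\<And>i. i \<ge> 2 \<Longrightarrow> rpow s x i * s \<in> J"
  shows "nilpotent (s * x)"
proof -
  note J_ideal = ideal_add[OF J(1)] ideal_diff[OF J(1)] ideal_mult_left[OF J(1)]
    ideal_mult_right[OF J(1)] ideal_rpow[OF J(1)]
  define e where "e = s + x - s * x"
  define F where "F k = rpow s e k * s" for k
  define p where "p = s * x"
  have "nilpotent (s * s)" using J s by (auto simp: nil_set_def Nil_set_def)
  then have "nilpotent (circ s x)" by (intro circ x) (rule nilpotent_of_square)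
  then obtain n where n: "\<And>u. rpow u e n = 0" by (auto simp: nilpotent_iff_rpow e_def circ_def)
  \<comment> \<open>Of the three terms of \<open>s x^i e\<close>, those through
    \<open>s x^i s\<close> lie in \<open>J\<close> and the third has a larger
    \<open>i\<close>.\<close>
  have high: "rpow (rpow s x i) e k * s \<in> J" if "i \<ge> 2" for i k
    using that
  proof (induction k arbitrary: i)
    case 0
    then show ?case by (simp add: sxs)
  next
    case (Suc k)
    have "rpow (rpow s x i) e (Suc k) * s
        = rpow (rpow s x i * s) e k * s + rpow (rpow s x (Suc i)) e k * s
          - rpow (rpow s x i * s * x) e k * s"
      by (simp only: rpow_Suc_left[of _ e])
        (simp add: e_def ring_distribs rpow_plus rpow_diff flip: mult.assoc)
    moreover have "rpow s x i * s \<in> J" by (rule sxs[OF Suc.prems])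
    ultimately show ?case
      using Suc.IH[of "Suc i"] Suc.prems by (simp add: J_ideal del: rpow.simps)
  qed
  \<comment> \<open>Modulo \<open>J\<close>, \<open>s e e\<close> is
    \<open>p s + s x^2 - p p\<close> and \<open>p s e\<close> is \<open>p p\<close>;
    \<open>high\<close> disposes of \<open>s x^2\<close>.\<close>
  have rec: "p * F k - (F (Suc (Suc k)) + p * F (Suc k)) \<in> J" for k
  proof -
    have se: "s * e = p + (s * s - s * s * x)"
      by (simp add: e_def p_def algebra_simps)
    have "s * e * e = p * s + rpow s x 2 - p * p + (s * s - s * s * x) * e"
      by (simp only: se distrib_right)
        (simp add: e_def p_def numeral_2_eq_2 algebra_simps)
    moreover have "p * (s * e) = p * p + p * (s * s - s * s * x)"
      by (simp add: se algebra_simps)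
    ultimately have "p * s - (s * e * e + p * (s * e))
        = - rpow s x 2 - ((s * s - s * s * x) * e + p * (s * s - s * s * x))"
      by simp
    then have "rpow (p * s - (s * e * e + p * (s * e))) e k * s
        = rpow (0 - rpow s x 2 - ((s * s - s * s * x) * e + p * (s * s - s * s * x))) e k * s"
      by simp
    moreover have "rpow (p * s - (s * e * e + p * (s * e))) e k * s
        = p * F k - (F (Suc (Suc k)) + p * F (Suc k))"
      by (simp only: F_def rpow_Suc_left rpow_plus rpow_diff rpow_mult ring_distribs mult.assoc)
    moreover have "rpow (0 - rpow s x 2 - ((s * s - s * s * x) * e + p * (s * s - s * s * x))) e k * s
        = 0 - rpow (rpow s x 2) e k * s
          - rpow ((s * s - s * s * x) * e + p * (s * s - s * s * x)) e k * s"
      by (simp only: rpow_diff[of "0 - rpow s x 2"] rpow_diff[of 0] left_diff_distrib rpow_zero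
          mult_zero_left)
    moreover have "\<dots> \<in> J"
      using s by (simp add: J_ideal ideal_zero[OF J(1)] high del: diff_0)
    ultimately show ?thesis by simp
  qed
  have right: "((*) p ^^ j) a * b = ((*) p ^^ j) (a * b)" for a b j
    by (induction j) (auto simp: mult.assoc)
  have lin: "((*) p ^^ j) (a + b) = ((*) p ^^ j) a + ((*) p ^^ j) b" for a b j
    by (induction j) (auto simp: distrib_left)
  have stay: "((*) p ^^ j) a \<in> J" if "a \<in> J" for a j
    using that by (induction j) (auto intro: ideal_mult_left[OF J(1)])
  \<comment> \<open>The recursion trades one factor \<open>p\<close> for a higher index of
    \<open>F\<close>, until \<open>e^n = 0\<close> applies.\<close>
  have down: "((*) p ^^ j) (F k) \<in> J" if "n \<le> k + j" for j k
    using that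
  proof (induction j arbitrary: k)
    case 0
    then obtain i where "k = n + i" using le_Suc_ex by auto
    then show ?case using n ideal_zero[OF J(1)] by (simp add: F_def rpow_add)
  next
    case (Suc j)
    let ?d = "p * F k - (F (Suc (Suc k)) + p * F (Suc k))"
    have "((*) p ^^ Suc j) (F k) = ((*) p ^^ j) (?d + (F (Suc (Suc k)) + p * F (Suc k)))"
      by (simp add: funpow_swap1)
    also have "\<dots> = ((*) p ^^ j) ?d + (((*) p ^^ j) (F (Suc (Suc k))) + p * ((*) p ^^ j) (F (Suc k)))"
      by (simp only: lin) (simp add: funpow_swap1)
    also have "\<dots> \<in> J"
      using Suc.prems by (intro ideal_add[OF J(1)] ideal_mult_left[OF J(1)] stay rec Suc.IH) auto
    finally show ?case .
  qed
  \<comment> \<open>\<open>F 1 * x = s e s x\<close> is \<open>p p\<close> modulo \<open>J\<close>,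
    so \<open>p^(n+2)\<close> lies in \<open>J\<close>.\<close>
  have "((*) p ^^ n) (F 1 * x) \<in> J"
    using ideal_mult_right[OF J(1) down[of 1 n]] by (simp add: right)
  moreover have "((*) p ^^ n) ((s * s * x - s * s) * p) \<in> J"
    using s by (simp add: stay ideal_diff[OF J(1)] ideal_mult_right[OF J(1)])
  moreover have "p * p = F 1 * x + (s * s * x - s * s) * p"
    by (simp add: F_def e_def p_def algebra_simps)
  ultimately have "((*) p ^^ n) (p * p) \<in> J"
    by (simp only: lin ideal_add[OF J(1)])
  then have "npow p (Suc n) \<in> J" by (simp add: npow_def funpow_swap1)
  then have "nilpotent p"
    using J(2) nilpotent_of_npow by (auto simp: nil_set_def Nil_set_def)
  then show ?thesis by (simp add: p_def)
qed

text \<open>Descending induction on \<open>i\<close> establishes the insertion property of \<open>x\<^bsup>i+1\<^esup>\<close>: the previous lemma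
  needs it for the proper powers.\<close>

lemma circ_closed_imp_insertion:
  assumes circ: "\<And>x y :: 'a::ring. nilpotent x \<Longrightarrow> nilpotent y \<Longrightarrow> nilpotent (circ x y)"
    and x: "nilpotent (x :: 'a)"
  shows "insertion nil_radical x"
proof -
  have ideal: "two_sided_ideal (nil_radical :: 'a set)"
    by (rule circ_closed_imp_ideal_nil_radical[OF circ])
  obtain n where n: "\<And>u. rpow u x n = 0" using x by (auto simp: nilpotent_iff_rpow)
  have "insertion nil_radical (npow x i)" for i
  proof (induction "n - i" arbitrary: i rule: less_induct)
    case less
    show ?case
    proof (cases "n \<le> i")
      case True
      then have "npow x i = 0" using n by (auto simp: npow_eq_rpow rpow_add dest: le_Suc_ex)
      then show ?thesis by (simp add: insertion_def ideal_zero[OF ideal])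
    next
      case False
      have powers: "insertion nil_radical (npow x j)" if "i < j" for j
        using False that by (intro less) simp
      show ?thesis
      proof (intro insertion_nil_radicalI nilpotent_mult_square_in_ideal_if_circ_closed[OF circ ideal]
          nil_set_nil_radical sandwich_square_in_nil_radical nilpotent_npow x)
        fix u v r :: 'a and k :: nat
        assume uv: "u * v \<in> nil_radical" and k: "k \<ge> 2"
        \<comment> \<open>\<open>npow x j\<close> is \<open>x^(j+1)\<close>, hence the shift;
          \<open>k \<ge> 2\<close> makes it a proper power of \<open>npow x i\<close>.\<close>
        define j where "j = Suc i * k - 1"
        have "Suc i * 2 \<le> Suc i * k" using k by (intro mult_le_mono2)
        then have j: "Suc i * k = Suc j" "i < j" by (auto simp: j_def)
        have "u * npow x j * v \<in> nil_radical"
          using powers[OF j(2)] uv by (simp add: insertion_def)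
        then have "v * r * (u * npow x j * v) * (r * u) \<in> nil_radical"
          using nil_radical_mult_right nil_radical_mult_left by blast
        moreover have "rpow (v * r * u) (npow x i) k = v * r * u * npow x j"
          by (simp only: rpow_npow j(1) rpow_Suc_npow)
        ultimately show "rpow (v * r * u) (npow x i) k * (v * r * u) \<in> nil_radical"
          by (simp add: mult.assoc)
      qed
    qed
  qed
  from this[of 0] show ?thesis by simp
qed
theorem theorem2p6:
  fixes R :: "'a::ring itself"
  defines "N \<equiv> (Nil_set :: 'a set)"
  shows "((\<forall>x\<in>N. \<forall>y\<in>N. x + y \<in> N) \<longleftrightarrow>
           ((\<forall>x\<in>N. \<forall>y\<in>N. x * y \<in> N) \<and> satisfies_Koethe R))
       \<and> ((\<forall>x\<in>N. \<forall>y\<in>N. x + y \<in> N) \<longleftrightarrow> (\<forall>x\<in>N. \<forall>y\<in>N. circ x y \<in> N))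
       \<and> ((\<forall>x\<in>N. \<forall>y\<in>N. x + y \<in> N) \<longleftrightarrow> subring N)"
proof -
  have N: "x \<in> N \<longleftrightarrow> nilpotent x" for x by (simp add: N_def Nil_set_def)
  have R: "satisfies_Koethe R \<longleftrightarrow> satisfies_Koethe TYPE('a)" by (simp add: satisfies_Koethe_def)
  have zero: "nilpotent (0 :: 'a)" by (auto simp: nilpotent_def intro: exI[of _ 0])
  have diff: "nilpotent (x - y)"
    if "\<forall>x\<in>N. \<forall>y\<in>N. x + y \<in> N" "nilpotent x" "nilpotent y" for x y :: 'a
    using that nilpotent_uminus[of y] by (metis N diff_conv_add_uminus)
  have mult: "nilpotent (x * y)"
    if add: "\<forall>x\<in>N. \<forall>y\<in>N. x + y \<in> N" and xy: "nilpotent x" "nilpotent y" for x y :: 'a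
    by (rule nilpotent_closed_if_insertion(2)[OF add_closed_imp xy]) (use add N in auto)
  have Koethe: "satisfies_Koethe R" if add: "\<forall>x\<in>N. \<forall>y\<in>N. x + y \<in> N"
  proof -
    \<comment> \<open>A single nil ideal serves every nil left ideal at once.\<close>
    have "two_sided_ideal (nil_radical :: 'a set)" by (rule add_closed_imp) (use add N in auto)
    then show ?thesis
      unfolding R satisfies_Koethe_def
      using nil_set_nil_radical nil_left_ideal_subset_nil_radical by blast
  qed
  have from_mult: "nilpotent (x + y)"
    if h: "\<forall>x\<in>N. \<forall>y\<in>N. x * y \<in> N" "satisfies_Koethe R" and xy: "nilpotent x" "nilpotent y" for x y :: 'a
    by (rule nilpotent_closed_if_insertion(1)[OF Koethe_imp_ideal_nil_radical
          mult_closed_imp_insertion xy]) (use h N R in auto)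
  have from_circ: "nilpotent (x + y)"
    if h: "\<forall>x\<in>N. \<forall>y\<in>N. circ x y \<in> N" and xy: "nilpotent x" "nilpotent y" for x y :: 'a
    by (rule nilpotent_closed_if_insertion(1)[OF circ_closed_imp_ideal_nil_radical
          circ_closed_imp_insertion xy]) (use h N in auto)
  have from_subring: "x + y \<in> N" if "subring N" "x \<in> N" "y \<in> N" for x y
  proof -
    have "- y \<in> N" using that(3) by (simp add: N nilpotent_uminus)
    then have "x - (- y) \<in> N"
      using that unfolding subring_def additive_subgroup_def by blast
    then show ?thesis by simp
  qed
  have to_circ: "circ x y \<in> N" if "\<forall>x\<in>N. \<forall>y\<in>N. x + y \<in> N" "x \<in> N" "y \<in> N" for x y
    using that diff[OF that(1)] mult[OF that(1)] by (simp add: circ_def N)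
  have to_subring: "subring N" if "\<forall>x\<in>N. \<forall>y\<in>N. x + y \<in> N"
    using diff[OF that] mult[OF that] zero by (simp add: subring_def additive_subgroup_def N)
  let ?add = "\<forall>x\<in>N. \<forall>y\<in>N. x + y \<in> N"
  have "?add \<longleftrightarrow> (\<forall>x\<in>N. \<forall>y\<in>N. x * y \<in> N) \<and> satisfies_Koethe R"
  proof (intro iffI conjI)
    assume add: ?add
    show "\<forall>x\<in>N. \<forall>y\<in>N. x * y \<in> N" using mult[OF add] by (simp add: N)
    show "satisfies_Koethe R" by (rule Koethe[OF add])
  next
    assume h: "(\<forall>x\<in>N. \<forall>y\<in>N. x * y \<in> N) \<and> satisfies_Koethe R"
    show ?add using from_mult[OF conjunct1[OF h] conjunct2[OF h]] by (simp add: N)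
  qed
  moreover have "?add \<longleftrightarrow> (\<forall>x\<in>N. \<forall>y\<in>N. circ x y \<in> N)"
  proof
    assume add: ?add
    show "\<forall>x\<in>N. \<forall>y\<in>N. circ x y \<in> N" by (intro ballI to_circ[OF add])
  next
    assume h: "\<forall>x\<in>N. \<forall>y\<in>N. circ x y \<in> N"
    show ?add using from_circ[OF h] by (simp add: N)
  qed
  moreover have "?add \<longleftrightarrow> subring N"
  proof
    assume ?add
    then show "subring N" by (rule to_subring)
  next
    assume "subring N"
    then show ?add by (intro ballI from_subring)
  qed
  ultimately show ?thesis by (intro conjI)
qed

end
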